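(* Let $\mathcal{A}$ be a Rickart *-ring. Then each of the binary relations $\preceq^{r*|\ell\square}$, $\preceq^{r*|r\square}$ and $\preceq^{r*|\square}$ on $\mathcal{A}$, defined for $a,b\in\mathcal{A}$ by - $a\preceq^{r*|\ell\square} b$ iff $a\,\mathrm{rp}(b)=a=b\,\mathrm{rp}(a)$ and $a^2=ab$, - $a\preceq^{r*|r\square} b$ iff $a\,\mathrm{rp}(b)=a=b\,\mathrm{rp}(a)$ and $a^2=ba$, - $a\preceq^{r*|\square} b$ iff $a\,\mathrm{rp}(b)=a=b\,\mathrm{rp}(a)$ and $a^2=ab=ba$, is a partial order on $\mathcal{A}$.
   Context: A *-ring is an (associative) ring $\mathcal{A}$ with an involution $*$: $(a+b)^*=a^*+b^*$, $(ab)^*=b^*a^*$, $(a^* )^*=a$. It is a Rickart *-ring if for every $a\in\mathcal{A}$ there is a self-adjoint idempotent $p$ (i.e. $p=p^*=p^2$) with $\{x\in\mathcal{A}: xa=0\}=\mathcal{A}(1-p)$; such a ring has an identity $1$, and $p$ is unique and denoted $\mathrm{lp}(a)$. Likewise, for every $a$ there is a unique self-adjoint idempotent $\mathrm{rp}(a)$ with $\{x\in\mathcal{A}: ax=0\}=(1-\mathrm{rp}(a))\mathcal{A}$. *)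

theory Defs
  imports Main
begin

class star_ring = ring +
  fixes star :: "'a \<Rightarrow> 'a"
  assumes star_add: "star (a + b) = star a + star b"
    and star_mult: "star (a * b) = star b * star a"
    and star_star: "star (star a) = a"
begin

definition projection :: "'a \<Rightarrow> bool" where
  "projection p \<longleftrightarrow> star p = p \<and> p * p = p"

end

(* The identity is supplied by monoid_mult rather than by ring_1: the latter
   postulates 0 \<noteq> 1 and would exclude the zero ring, which is a Rickart *-ring. *)
class rickart_star_ring = star_ring + monoid_mult +
  assumes ex_left_projection:
    "\<exists>p. projection p \<and> {x. x * a = 0} = {y * (1 - p) |y. True}"
begin

definition rp :: "'a \<Rightarrow> 'a" where
  "rp a = (THE p. projection p \<and> {x. a * x = 0} = {(1 - p) * y |y. True})"

definition le_right_star_left :: "'a \<Rightarrow> 'a \<Rightarrow> bool" where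
  "le_right_star_left a b \<longleftrightarrow>
     a * rp b = a \<and> a = b * rp a \<and> a\<^sup>2 = a * b"

definition le_right_star_right :: "'a \<Rightarrow> 'a \<Rightarrow> bool" where
  "le_right_star_right a b \<longleftrightarrow>
     a * rp b = a \<and> a = b * rp a \<and> a\<^sup>2 = b * a"

definition le_right_star_both :: "'a \<Rightarrow> 'a \<Rightarrow> bool" where
  "le_right_star_both a b \<longleftrightarrow>
     a * rp b = a \<and> a = b * rp a \<and> a\<^sup>2 = a * b \<and> a * b = b * a"

end

lemma star_zero: "star (0::'a::star_ring) = 0"
  using star_add[of "0::'a" 0] by simp

lemma star_minus: "star (- a) = - star (a::'a::star_ring)"
  using star_add[of a "- a"] by (simp add: star_zero minus_unique)

lemma star_diff: "star (a - b) = star a - star (b::'a::star_ring)"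
  using star_add[of a "- b"] by (simp add: star_minus)

lemma star_one: "star (1::'a::rickart_star_ring) = 1"
  by (metis mult.left_neutral mult.right_neutral star_mult star_star)

lemma ex1_right_projection:
  fixes a :: "'a::rickart_star_ring"
  shows "\<exists>!p. projection p \<and> {x. a * x = 0} = {(1 - p) * y |y. True}"
proof -
  obtain p where p: "projection p"
    and ann: "{x. x * star a = 0} = {y * (1 - p) |y. True}"
    using ex_left_projection by blast
  have sp: "star (1 - p) = 1 - p"
    using p by (simp add: projection_def star_diff star_one)
  have "a * x = 0 \<longleftrightarrow> (\<exists>y. x = (1 - p) * y)" for x
  proof -
    have "a * x = 0 \<longleftrightarrow> star x * star a = 0"
      by (metis star_mult star_star star_zero)
    also have "\<dots> \<longleftrightarrow> (\<exists>y. star x = y * (1 - p))"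
      using ann by blast
    also have "\<dots> \<longleftrightarrow> (\<exists>y. x = (1 - p) * y)"
      by (metis sp star_mult star_star)
    finally show ?thesis .
  qed
  then have ex: "{x. a * x = 0} = {(1 - p) * y |y. True}"
    by blast
  have absorb: "q * r = q"
    if q: "projection q" "{x. a * x = 0} = {(1 - q) * y |y. True}"
      and r: "{x. a * x = 0} = {(1 - r) * y |y. True}" for q r :: 'a
  proof -
    have "1 - r \<in> {(1 - r) * y |y. True}"
      by (metis (mono_tags, lifting) mem_Collect_eq mult.right_neutral)
    then obtain y where "1 - r = (1 - q) * y"
      using q(2) r by auto
    then have "q * (1 - r) = (q - q * q) * y"
      by (simp add: right_diff_distrib mult.assoc [symmetric])
    then show ?thesis
      using q(1) by (simp add: projection_def right_diff_distrib)
  qed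
  show ?thesis
  proof (rule ex1I[of _ p])
    show "projection p \<and> {x. a * x = 0} = {(1 - p) * y |y. True}"
      using p ex by blast
  next
    fix q assume q: "projection q \<and> {x. a * x = 0} = {(1 - q) * y |y. True}"
    have "q * p = q" "p * q = p"
      using absorb p ex q by blast+
    then show "q = p"
      using p q by (metis projection_def star_mult)
  qed
qed

end

theory Submission
  imports Defs
begin

text \<open>
  Since \<open>a * x = 0\<close> iff \<open>rp a * x = 0\<close>, the condition \<open>a * rp b = a\<close> says
  \<open>rp a \<le> rp b\<close> in the order of projections, so \<open>a = c * rp a\<close> whenever \<open>a \<preceq> b \<preceq> c\<close>. For the left relation, \<open>a\<^sup>2 = a * b\<close> can
  be rewritten as \<open>rp a * a = rp a * b\<close>, whence
  \<open>rp a * c = rp a * rp b * c = rp a * rp b * b = rp a * a\<close>. For the right relation,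
  \<open>c * a = c * b * rp a = b\<^sup>2 * rp a = b * a = a\<^sup>2\<close>.
\<close>

context
  fixes a :: "'a::rickart_star_ring"
begin

lemma rp_spec: "projection (rp a) \<and> {x. a * x = 0} = {(1 - rp a) * y |y. True}"
  unfolding rp_def by (rule theI'[OF ex1_right_projection])

lemma star_rp: "star (rp a) = rp a"
  and rp_idem: "rp a * rp a = rp a"
  using rp_spec by (simp_all add: projection_def)

lemma rp_ann_iff: "rp a * x = 0 \<longleftrightarrow> a * x = 0"
proof
  assume "rp a * x = 0"
  then have "x = (1 - rp a) * x" by (simp add: left_diff_distrib)
  then show "a * x = 0" using rp_spec by blast
next
  assume "a * x = 0"
  then obtain y where "x = (1 - rp a) * y" using rp_spec by blast
  then show "rp a * x = 0"
    by (simp add: mult.assoc[symmetric] right_diff_distrib rp_idem)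
qed

text \<open>The equivalence of annihilators, applied to the difference \<open>x - y\<close>.\<close>

lemma rp_cancel_iff: "rp a * x = rp a * y \<longleftrightarrow> a * x = a * y"
  using rp_ann_iff[of "x - y"] by (simp add: right_diff_distrib)

lemma mult_rp: "a * rp a = a"
  using rp_cancel_iff[of "rp a" 1] by (simp add: rp_idem)

text \<open>Cancellation with \<open>y = 1\<close>: the left side reads
  \<open>a * rp b = a * 1\<close>.\<close>

lemma mult_rp_eq_iff: "a * rp b = a \<longleftrightarrow> rp a * rp b = rp a"
  using rp_cancel_iff[of "rp b" 1] by simp

end

text \<open>Apply \<open>star\<close> to \<open>rp a * rp b = rp a\<close>; both projections are
  self-adjoint.\<close>

lemma rp_absorb_commute:
  fixes a b :: "'a::rickart_star_ring"
  assumes "a * rp b = a"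
  shows "rp b * rp a = rp a"
  using assms by (metis mult_rp_eq_iff star_mult star_rp)

lemma rp_order_trans:
  fixes a b c :: "'a::rickart_star_ring"
  assumes "a * rp b = a" "a = b * rp a" "b * rp c = b" "b = c * rp b"
  shows "a * rp c = a" "a = c * rp a"
proof -
  show "a * rp c = a"
    using assms(1,3) by (metis mult.assoc mult_rp_eq_iff)
  \<comment> \<open>Insert \<open>rp b\<close> in front of \<open>rp a\<close>:
    \<open>c * rp a = c * rp b * rp a = b * rp a = a\<close>.\<close>
  show "a = c * rp a"
    using assms(2,4) rp_absorb_commute[OF assms(1)] by (metis mult.assoc)
qed

text \<open>Cancellation turns \<open>b * b = b * c\<close> into \<open>rp b * b = rp b * c\<close>.
  Multiplying by \<open>a\<close> on the left and absorbing \<open>rp b\<close> into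
  \<open>a\<close> gives \<open>a * b = a * c\<close>.\<close>

lemma square_left_trans:
  fixes a b c :: "'a::rickart_star_ring"
  assumes "a * rp b = a" "a\<^sup>2 = a * b" "b\<^sup>2 = b * c"
  shows "a\<^sup>2 = a * c"
proof -
  have "rp b * b = rp b * c"
    using assms(3) by (simp add: rp_cancel_iff power2_eq_square)
  then have "a * b = a * c"
    using assms(1) by (metis mult.assoc)
  then show ?thesis using assms(2) by simp
qed

lemma square_right_trans:
  fixes a b c :: "'a::rickart_star_ring"
  assumes "a = b * rp a" "a\<^sup>2 = b * a" "b\<^sup>2 = c * b"
  shows "a\<^sup>2 = c * a"
  using assms by (metis mult.assoc power2_eq_square)

text \<open>Presents the two-sided relation as an intersection, so that it inherits the order axioms
  from the one-sided relations.\<close>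

lemma le_right_star_both_iff:
  "le_right_star_both a b \<longleftrightarrow> le_right_star_left a b \<and> le_right_star_right a b"
  by (auto simp: le_right_star_both_def le_right_star_left_def le_right_star_right_def)

lemma partial_order_on_UNIV_relI:
  assumes "\<And>a. P a a"
    and "\<And>a b. P a b \<Longrightarrow> P b a \<Longrightarrow> a = b"
    and "\<And>a b c. P a b \<Longrightarrow> P b c \<Longrightarrow> P a c"
  shows "partial_order_on UNIV {(a, b). P a b}"
  unfolding partial_order_on_def preorder_on_def
  using assms by (auto intro!: refl_onI antisymI transI)

lemma le_right_star_left_refl: "le_right_star_left a a"
  and le_right_star_right_refl: "le_right_star_right a a"
  by (simp_all add: le_right_star_left_def le_right_star_right_def mult_rp power2_eq_square)

text \<open>The first relation gives \<open>a = b * rp a\<close>, the second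
  \<open>b * rp a = b\<close>.\<close>

lemma le_right_star_left_antisym:
  "le_right_star_left a b \<Longrightarrow> le_right_star_left b a \<Longrightarrow> a = b"
  and le_right_star_right_antisym:
  "le_right_star_right a b \<Longrightarrow> le_right_star_right b a \<Longrightarrow> a = b"
  unfolding le_right_star_left_def le_right_star_right_def by metis+

lemma le_right_star_left_trans:
  "le_right_star_left a b \<Longrightarrow> le_right_star_left b c \<Longrightarrow> le_right_star_left a c"
  unfolding le_right_star_left_def by (blast intro: rp_order_trans square_left_trans)

lemma le_right_star_right_trans:
  "le_right_star_right a b \<Longrightarrow> le_right_star_right b c \<Longrightarrow> le_right_star_right a c"
  unfolding le_right_star_right_def by (blast intro: rp_order_trans square_right_trans)

theorem theorem6:
  shows "partial_order_on UNIV {(a :: 'a :: rickart_star_ring, b). le_right_star_left a b} \<and>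
    partial_order_on UNIV {(a :: 'a, b). le_right_star_right a b} \<and>
    partial_order_on UNIV {(a :: 'a, b). le_right_star_both a b}"
proof (intro conjI; rule partial_order_on_UNIV_relI)
qed (unfold le_right_star_both_iff,
    (blast intro: le_right_star_left_refl le_right_star_right_refl
      dest: le_right_star_left_antisym le_right_star_right_antisym
        le_right_star_left_trans le_right_star_right_trans)+)

end
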